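(* Let $\{\mathbf{h}^{n-1/2}\}_{n\ge 0}$, $\{\mathbf{e}^n\}_{n\ge 0}$, $\{\mathbf{p}_i^n\}_{n\ge 0}$ ($i\ge 1$) be sequences of real vectors which satisfy, for all integers $n\ge 0$, \begin{align*} \mathsf{M_h}\, d_\tau \mathbf{h}^{n} + \mathsf{C}\,\mathbf{e}^{n} &= 0,\\ \mathsf{M_e}\, d_\tau \mathbf{e}^{n+1/2} + \sum_i d_\tau \mathbf{p}_i^{n+1/2} - \mathsf{C}^{\mathsf{T}}\,\mathbf{h}^{n+1/2} &= 0,\\ \mathsf{M_{d,i}}\, d_\tau \mathbf{p}_i^{n+1/2} + \mathsf{M_{p,i}}\,\overline{\mathbf{p}}_i^{\,n+1/2} &= \overline{\mathbf{e}}^{\,n+1/2}, \qquad i\ge 1. \end{align*} Define the discrete energy at time step $t^n=n\tau$ by $$\mathcal{E}^{n} = \frac12\Big( (\mathbf{h}^{n+1/2},\mathbf{h}^{n-1/2})_{\mathsf{M_h}} + \|\mathbf{e}^n\|^2_{\mathsf{M_e}} + \sum_i \|\mathbf{p}_i^n\|^2_{\mathsf{M_{p,i}}}\Big).$$ Then $$ d_\tau \mathcal{E}^{n+1/2} = -\sum_i \| d_\tau \mathbf{p}_i^{n+1/2}\|^2_{\mathsf{M_{d,i}}}, \qquad n\ge 0.$$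
   Context: Setting: a leapfrog time discretization, combined with a space discretization, of Maxwell's equations in a multipole Debye medium. Here $\tau>0$ is the time step size and $t^s=s\tau$. The vectors $\mathbf{h}^{n+1/2}$ (magnetic field), $\mathbf{e}^n$ (electric field) and $\mathbf{p}_i^n$ (polarization components) are real finite-dimensional vectors of degrees of freedom, where $\mathbf{e}^n$ and all $\mathbf{p}_i^n$ lie in the same space. The matrix $\mathsf{C}$ is a real (possibly rectangular) matrix of compatible dimensions, and $\mathsf{M_h}$, $\mathsf{M_e}$, $\mathsf{M_{d,i}}$, $\mathsf{M_{p,i}}$ are real symmetric positive-definite matrices of compatible dimensions. The index $i\ge 1$ ranges over a finite or countably infinite set; if it is infinite, the sums over $i$ appearing in the scheme and in the energy are assumed to converge. Notation: for a quantity $u$ indexed by integers or half-integers, $d_\tau u^{s} = \frac1\tau (u^{s+1/2}-u^{s-1/2})$ is the central difference quotient and $\overline u^{\,s} = \frac12 (u^{s+1/2}+u^{s-1/2})$ is the average. In particular $d_\tau \mathcal{E}^{n+1/2}=\frac1\tau(\mathcal{E}^{n+1}-\mathcal{E}^n)$. For a symmetric positive-definite matrix $\mathsf{M}$, $(a,b)_{\mathsf{M}} = b^{\mathsf{T}}\mathsf{M}a$ and $\|a\|^2_{\mathsf{M}}=(a,a)_{\mathsf{M}}$. *)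

theory Defs
  imports "HOL-Analysis.Analysis"
begin

text \<open>
  Grid functions are functions of a real time index \<open>s\<close> (physical time \<open>s * \<tau>\<close>); only their values
  at integers and half-integers matter. The magnetic field is a sequence starting at \<open>h (- 1/2)\<close>.
\<close>

definition diff_quot :: "real \<Rightarrow> (real \<Rightarrow> 'v::real_vector) \<Rightarrow> real \<Rightarrow> 'v" where
  "diff_quot \<tau> u s = (1 / \<tau>) *\<^sub>R (u (s + 1/2) - u (s - 1/2))"

definition average :: "(real \<Rightarrow> 'v::real_vector) \<Rightarrow> real \<Rightarrow> 'v" where
  "average u s = (1 / 2) *\<^sub>R (u (s + 1/2) + u (s - 1/2))"

definition sym_pos_def :: "real^'n^'n \<Rightarrow> bool" where
  "sym_pos_def M \<longleftrightarrow> transpose M = M \<and> (\<forall>x. x \<noteq> 0 \<longrightarrow> x \<bullet> (M *v x) > 0)"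

definition inner_mat :: "real^'n^'n \<Rightarrow> real^'n \<Rightarrow> real^'n \<Rightarrow> real" where
  "inner_mat M a b = b \<bullet> (M *v a)"

definition normsq_mat :: "real^'n^'n \<Rightarrow> real^'n \<Rightarrow> real" where
  "normsq_mat M a = inner_mat M a a"

text \<open>
  Sums over a finite or infinite index set \<open>I\<close> of naturals. For infinite \<open>I\<close> this is the series
  taken in increasing order of the index, so only ordinary (possibly conditional) convergence is
  meant, unlike for \<^const>\<open>infsum\<close> and \<^const>\<open>summable_on\<close>.
\<close>

definition index_summable :: "nat set \<Rightarrow> (nat \<Rightarrow> 'v::real_normed_vector) \<Rightarrow> bool" where
  "index_summable I f \<longleftrightarrow> summable (\<lambda>i. if i \<in> I then f i else 0)"

definition index_sum :: "nat set \<Rightarrow> (nat \<Rightarrow> 'v::real_normed_vector) \<Rightarrow> 'v" where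
  "index_sum I f = (\<Sum>i. if i \<in> I then f i else 0)"

lemma index_summable_finite: "finite I \<Longrightarrow> index_summable I f"
  unfolding index_summable_def by (rule summable_finite) auto

lemma index_sum_finite: "finite I \<Longrightarrow> index_sum I f = sum f I"
  unfolding index_sum_def by (subst suminf_finite[where N = I]) (auto intro: sum.cong)

definition discrete_energy ::
  "real^'h^'h \<Rightarrow> real^'e^'e \<Rightarrow> nat set \<Rightarrow> (nat \<Rightarrow> real^'e^'e) \<Rightarrow>
   (real \<Rightarrow> real^'h) \<Rightarrow> (real \<Rightarrow> real^'e) \<Rightarrow> (nat \<Rightarrow> real \<Rightarrow> real^'e) \<Rightarrow> real \<Rightarrow> real" where
  "discrete_energy Mh Me I Mp h e p s =
     1/2 * (inner_mat Mh (h (s + 1/2)) (h (s - 1/2)) + normsq_mat Me (e s)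
            + index_sum I (\<lambda>i. normsq_mat (Mp i) (p i s)))"

end

theory Submission
  imports Defs
begin

text \<open>
  The identity comes from testing each equation of the scheme around the half step \<open>s = n + 1/2\<close>
  with a suitable vector: the electric equation with the average of \<open>e\<close>, each polarization equation
  with the difference quotient of \<open>p i\<close>, and the mean of the magnetic equations at \<open>n\<close> and \<open>n + 1\<close>
  with \<open>h s\<close>. Two discrete product rules turn the left-hand sides into difference quotients of the
  three parts of the energy: \<open>diff_quot_normsq_mat\<close> for the quantities living at integer times, and
  \<open>diff_quot_staggered_inner_mat\<close> for the magnetic part, whose product of two neighbouring half steps
  has a difference in which the middle value \<open>h s\<close> factors out. The curl terms cancel because \<open>C\<close> and
  its transpose are adjoint, the coupling terms between \<open>e\<close> and the \<open>p i\<close> cancel, and only the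
  dissipation by the \<open>Md i\<close> survives.

  For infinitely many poles, the tested polarization equation writes each dissipation term as a
  combination of terms whose series converge by hypothesis. This yields the
  convergence of the dissipation series together with its value (\<open>total_dissipation\<close>).
\<close>

lemma index_summable_iff_sums:
  "index_summable I f \<longleftrightarrow> (\<lambda>i. if i \<in> I then f i else 0) sums index_sum I f"
  by (simp add: index_summable_def index_sum_def summable_sums_iff)

lemma sums_imp_index_sum:
  assumes "(\<lambda>i. if i \<in> I then f i else 0) sums a"
  shows "index_summable I f" "index_sum I f = a"
  using assms by (auto simp: index_summable_def index_sum_def sums_iff)

lemma inner_symmetric_matrix:
  fixes M :: "real^'n^'n"
  assumes "transpose M = M"
  shows "x \<bullet> (M *v y) = y \<bullet> (M *v x)"
  by (metis assms dot_lmul_matrix inner_commute vector_transpose_matrix)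

text \<open>
  This is the factorization \<open>a\<^sup>2 - b\<^sup>2 = (a + b) (a - b)\<close> for a quadratic form; symmetry makes the
  mixed terms cancel.
\<close>

lemma diff_quot_normsq_mat:
  fixes u :: "real \<Rightarrow> real^'n"
  assumes "transpose M = M"
  shows "diff_quot \<tau> (\<lambda>s. normsq_mat M (u s)) s = 2 * (average u s \<bullet> (M *v diff_quot \<tau> u s))"
  using inner_symmetric_matrix[OF assms, of "u (s + 1/2)" "u (s - 1/2)"]
  by (simp add: diff_quot_def average_def normsq_mat_def inner_mat_def algebra_simps
      matrix_vector_mult_diff_distrib matrix_vector_mult_scaleR inner_diff_right inner_add_left)

text \<open>
  Both neighbouring products contain the middle value \<open>u s\<close>, so that their difference is
  \<open>u s\<close> paired with \<open>u (s + 1) - u (s - 1)\<close>, a sum of two consecutive increments.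
\<close>

lemma diff_quot_staggered_inner_mat:
  fixes u :: "real \<Rightarrow> real^'n"
  assumes "transpose M = M"
  shows "diff_quot \<tau> (\<lambda>s. inner_mat M (u (s + 1/2)) (u (s - 1/2))) s
         = 2 * (u s \<bullet> (M *v average (diff_quot \<tau> u) s))"
  using inner_symmetric_matrix[OF assms, of "u s" "u (s - 1)"]
  by (simp add: diff_quot_def average_def inner_mat_def algebra_simps
      matrix_vector_mult_diff_distrib matrix_vector_right_distrib
      matrix_vector_mult_scaleR inner_diff_right inner_add_right)

text \<open>
  The mean of two consecutive magnetic equations is taken because only the average of \<open>e\<close> at the half
  step \<open>s\<close> can cancel against the curl term of the electric equation, which lives at \<open>s\<close>.
\<close>

lemma magnetic_energy_balance:
  fixes h :: "real \<Rightarrow> real^'h" and e :: "real \<Rightarrow> real^'e"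
  assumes "transpose Mh = Mh"
    and "Mh *v diff_quot \<tau> h (s + 1/2) + C *v e (s + 1/2) = 0"
    and "Mh *v diff_quot \<tau> h (s - 1/2) + C *v e (s - 1/2) = 0"
  shows "diff_quot \<tau> (\<lambda>s. inner_mat Mh (h (s + 1/2)) (h (s - 1/2))) s
         = - 2 * (h s \<bullet> (C *v average e s))"
proof -
  have "Mh *v average (diff_quot \<tau> h) s = - (C *v average e s)"
    using assms(2,3)
    by (simp add: average_def matrix_vector_mult_scaleR matrix_vector_right_distrib
        eq_neg_iff_add_eq_0 flip: scaleR_add_right) (simp add: algebra_simps add_eq_0_iff)
  then show ?thesis
    by (simp add: diff_quot_staggered_inner_mat[OF assms(1)])
qed

text \<open>
  Testing with the average of \<open>e\<close>; moving \<open>C\<close> to the other side of the inner product produces exactly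
  the negative of the magnetic contribution.
\<close>

lemma electric_energy_balance:
  fixes h :: "real \<Rightarrow> real^'h" and e :: "real \<Rightarrow> real^'e"
  assumes "transpose Me = Me"
    and "Me *v diff_quot \<tau> e s + d - transpose C *v h s = 0"
  shows "diff_quot \<tau> (\<lambda>s. normsq_mat Me (e s)) s
         = 2 * (h s \<bullet> (C *v average e s)) - 2 * (average e s \<bullet> d)"
proof -
  have "Me *v diff_quot \<tau> e s = transpose C *v h s - d"
    using assms(2) by (simp add: algebra_simps)
  moreover have "average e s \<bullet> (transpose C *v h s) = h s \<bullet> (C *v average e s)"
    by (metis dot_lmul_matrix inner_commute vector_transpose_matrix transpose_transpose)
  ultimately show ?thesis
    by (simp add: diff_quot_normsq_mat[OF assms(1)] inner_diff_right)
qed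

text \<open>
  Testing with the difference quotient of \<open>p\<close>: the work done by the field on one pole is split into
  stored energy and dissipation. Solved for the dissipation, this is also what controls the
  dissipation series term by term.
\<close>

lemma polarization_energy_balance:
  fixes p e :: "real \<Rightarrow> real^'n"
  assumes "transpose Mp = Mp"
    and "Md *v diff_quot \<tau> p s + Mp *v average p s = average e s"
  shows "normsq_mat Md (diff_quot \<tau> p s)
         = average e s \<bullet> diff_quot \<tau> p s - 1/2 * diff_quot \<tau> (\<lambda>s. normsq_mat Mp (p s)) s"
proof -
  have "Md *v diff_quot \<tau> p s = average e s - Mp *v average p s"
    using assms(2) by (simp add: algebra_simps)
  then show ?thesis
    unfolding diff_quot_normsq_mat[OF assms(1)]
    using inner_symmetric_matrix[OF assms(1), of "average p s" "diff_quot \<tau> p s"]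
    by (simp add: normsq_mat_def inner_mat_def inner_diff_right inner_commute)
qed

text \<open>
  Because the averaged field \<open>average e s\<close> is the same for all poles, the work terms sum to its inner
  product with the total polarization current. Everything is a linear combination of convergent
  series, so that conditional convergence suffices.
\<close>

lemma total_dissipation:
  fixes p :: "nat \<Rightarrow> real \<Rightarrow> real^'n" and e :: "real \<Rightarrow> real^'n"
  assumes sym: "\<And>i. i \<in> I \<Longrightarrow> transpose (Mp i) = Mp i"
    and eq: "\<And>i. i \<in> I \<Longrightarrow>
          Md i *v diff_quot \<tau> (p i) s + Mp i *v average (p i) s = average e s"
    and d: "index_summable I (\<lambda>i. diff_quot \<tau> (p i) s)"
    and p1: "index_summable I (\<lambda>i. normsq_mat (Mp i) (p i (s + 1/2)))"
    and p0: "index_summable I (\<lambda>i. normsq_mat (Mp i) (p i (s - 1/2)))"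
  shows "index_summable I (\<lambda>i. normsq_mat (Md i) (diff_quot \<tau> (p i) s))"
    and "index_sum I (\<lambda>i. normsq_mat (Md i) (diff_quot \<tau> (p i) s))
         = average e s \<bullet> index_sum I (\<lambda>i. diff_quot \<tau> (p i) s)
           - 1/2 * diff_quot \<tau> (\<lambda>s. index_sum I (\<lambda>i. normsq_mat (Mp i) (p i s))) s"
      (is "_ = ?total")
proof -
  let ?z = "\<lambda>f i. if i \<in> I then f i else 0"
  let ?P = "\<lambda>s i. normsq_mat (Mp i) (p i s)"
  let ?D = "\<lambda>i. diff_quot \<tau> (p i) s"
  have "(\<lambda>i. average e s \<bullet> (if i \<in> I then ?D i else 0)
          - 1/2 * ((1/\<tau>) * (?z (?P (s + 1/2)) i - ?z (?P (s - 1/2)) i))) sums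
        (average e s \<bullet> index_sum I ?D
          - 1/2 * ((1/\<tau>) * (index_sum I (?P (s + 1/2)) - index_sum I (?P (s - 1/2)))))"
    using d p1 p0 unfolding index_summable_iff_sums
    by (intro sums_diff sums_mult bounded_linear.sums[OF bounded_linear_inner_right])
  moreover have "average e s \<bullet> (if i \<in> I then ?D i else 0)
          - 1/2 * ((1/\<tau>) * (?z (?P (s + 1/2)) i - ?z (?P (s - 1/2)) i))
        = ?z (\<lambda>i. normsq_mat (Md i) (?D i)) i" for i
    using polarization_energy_balance[OF sym eq, of i]
    by (simp add: diff_quot_def[of \<tau> "\<lambda>s. normsq_mat (Mp i) (p i s)"])
  ultimately have "?z (\<lambda>i. normsq_mat (Md i) (?D i)) sums ?total"
    by (simp add: diff_quot_def[of \<tau> "\<lambda>s. index_sum I (?P s)"])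
  from sums_imp_index_sum[OF this]
  show "index_summable I (\<lambda>i. normsq_mat (Md i) (?D i))"
    and "index_sum I (\<lambda>i. normsq_mat (Md i) (?D i)) = ?total" .
qed

lemma diff_quot_discrete_energy:
  "diff_quot \<tau> (discrete_energy Mh Me I Mp h e p) s
   = 1/2 * (diff_quot \<tau> (\<lambda>s. inner_mat Mh (h (s + 1/2)) (h (s - 1/2))) s
            + diff_quot \<tau> (\<lambda>s. normsq_mat Me (e s)) s
            + diff_quot \<tau> (\<lambda>s. index_sum I (\<lambda>i. normsq_mat (Mp i) (p i s))) s)"
  by (simp add: diff_quot_def discrete_energy_def algebra_simps)

theorem lemma1:
  fixes \<tau> :: real
    and I :: "nat set"
    and C :: "real^'e^'h"
    and Mh :: "real^'h^'h"
    and Me :: "real^'e^'e"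
    and Md Mp :: "nat \<Rightarrow> real^'e^'e"
    and h :: "real \<Rightarrow> real^'h"
    and e :: "real \<Rightarrow> real^'e"
    and p :: "nat \<Rightarrow> real \<Rightarrow> real^'e"
  assumes "\<tau> > 0"
    and "I \<subseteq> {1..}"
    and "sym_pos_def Mh"
    and "sym_pos_def Me"
    and "\<And>i. i \<in> I \<Longrightarrow> sym_pos_def (Md i)"
    and "\<And>i. i \<in> I \<Longrightarrow> sym_pos_def (Mp i)"
    and "\<And>n::nat. infinite I \<Longrightarrow> index_summable I (\<lambda>i. diff_quot \<tau> (p i) (real n + 1/2))"
    and "\<And>n::nat. infinite I \<Longrightarrow> index_summable I (\<lambda>i. normsq_mat (Mp i) (p i (real n)))"
    and "\<And>n::nat. Mh *v diff_quot \<tau> h (real n) + C *v e (real n) = 0"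
    and "\<And>n::nat. Me *v diff_quot \<tau> e (real n + 1/2)
            + index_sum I (\<lambda>i. diff_quot \<tau> (p i) (real n + 1/2))
            - transpose C *v h (real n + 1/2) = 0"
    and "\<And>(n::nat) i. i \<in> I \<Longrightarrow>
            Md i *v diff_quot \<tau> (p i) (real n + 1/2) + Mp i *v average (p i) (real n + 1/2)
            = average e (real n + 1/2)"
  shows "\<forall>n::nat.
           index_summable I (\<lambda>i. normsq_mat (Md i) (diff_quot \<tau> (p i) (real n + 1/2))) \<and>
           diff_quot \<tau> (discrete_energy Mh Me I Mp h e p) (real n + 1/2)
           = - index_sum I (\<lambda>i. normsq_mat (Md i) (diff_quot \<tau> (p i) (real n + 1/2)))"
proof (intro allI)
  fix n :: nat
  define s where "s = real n + 1/2"
  have up: "s + 1/2 = real (Suc n)" and down: "s - 1/2 = real n"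
    by (simp_all add: s_def)
  have summable_d: "index_summable I (\<lambda>i. diff_quot \<tau> (p i) s)"
    using assms(7)[of n] index_summable_finite unfolding s_def by blast
  have summable_p: "index_summable I (\<lambda>i. normsq_mat (Mp i) (p i (real m)))" for m
    using assms(8)[of m] index_summable_finite by blast
  have sym: "transpose Mh = Mh" "transpose Me = Me" "\<And>i. i \<in> I \<Longrightarrow> transpose (Mp i) = Mp i"
    using assms(3,4,6) by (auto simp: sym_pos_def_def)
  note magnetic = magnetic_energy_balance[OF sym(1), of \<tau> h s C e, unfolded up down,
      OF assms(9) assms(9)]
  note electric = electric_energy_balance[of Me \<tau> e s _ C h, OF sym(2) assms(10)[of n, folded s_def]]
  note dissipation = total_dissipation[OF sym(3) assms(11)[of _ n, folded s_def] summable_d,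
      unfolded up down, OF _ _ summable_p summable_p, simplified]
  show "index_summable I (\<lambda>i. normsq_mat (Md i) (diff_quot \<tau> (p i) (real n + 1/2))) \<and>
        diff_quot \<tau> (discrete_energy Mh Me I Mp h e p) (real n + 1/2)
        = - index_sum I (\<lambda>i. normsq_mat (Md i) (diff_quot \<tau> (p i) (real n + 1/2)))"
    unfolding s_def[symmetric] diff_quot_discrete_energy magnetic electric
    using dissipation by simp
qed

end
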